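(* For the two-dimensional forward Euler update of the discrete volume conservation law $$\overline J_{i,j}^{\Delta t}=\overline J_{i,j}-\frac{\Delta t}{\Delta\xi_1}\sum_{\mu=1}^Q\omega_\mu\Big(\big(J\tfrac{\partial\xi_1}{\partial t}\big)^\mu_{i+\frac12,j}-\big(J\tfrac{\partial\xi_1}{\partial t}\big)^\mu_{i-\frac12,j}\Big)-\frac{\Delta t}{\Delta\xi_2}\sum_{\mu=1}^Q\omega_\mu\Big(\big(J\tfrac{\partial\xi_2}{\partial t}\big)^\mu_{i,j+\frac12}-\big(J\tfrac{\partial\xi_2}{\partial t}\big)^\mu_{i,j-\frac12}\Big),$$ with the metric fluxes given in the context, assume that $\overline J_{i,j}>0$ for all $i$ and $j$. If $J_{i_\mu,j_\nu}>0$ for all $i,j,\mu,\nu$, then $\overline J_{i,j}^{\Delta t}>0$ holds (for all $i,j$) under the condition $$\Delta t\le\frac12\min\Big\{\frac{\omega_1\,\Delta\xi_1}{(\beta_1)_J},\ \frac{\omega_1\,\Delta\xi_2}{(\beta_2)_J}\Big\}.$$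
   Context: Uniform computational cells $I_{i,j}=[(\xi_1)_{i-1/2},(\xi_1)_{i+1/2}]\times[(\xi_2)_{j-1/2},(\xi_2)_{j+1/2}]$ of size $\Delta\xi_1\times\Delta\xi_2$; values outside the domain are supplied by boundary conditions (ghost cells), and "for all $i,j$" includes these. $J$ is the Jacobian determinant of the moving-mesh map from computational to physical space, $\overline J_{i,j}$ its cell average at the current time level, and $\Delta t>0$ the time step. $\omega_1,\dots,\omega_Q>0$ ($\sum_\mu\omega_\mu=1$, $\omega_1=\omega_Q$, $Q=4$) are the Gauss–Lobatto weights. $J_{i_\mu,j_\nu}$ is a reconstructed value of $J$ at the tensor-product Gauss–Lobatto node $((\xi_1)_{i_\mu},(\xi_2)_{j_\nu})$ of $I_{i,j}$ (nodes $1$ and $Q$ in each direction being the cell endpoints); the reconstruction satisfies $\sum_{\mu,\nu}\omega_\mu\omega_\nu J_{i_\mu,j_\nu}=\overline J_{i,j}$. A superscript $\mu$ with subscript $i\pm\frac12,j$ (resp. $i,j\pm\frac12$) denotes a value at $((\xi_1)_{i\pm1/2},(\xi_2)_{j_\mu})$ (resp. $((\xi_1)_{i_\mu},(\xi_2)_{j\pm1/2})$). Traces: $J^{-,\mu}_{i+1/2,j}=J_{i_Q,j_\mu}$, $J^{+,\mu}_{i-1/2,j}=J_{i_1,j_\mu}$, $J^{-,\mu}_{i,j+1/2}=J_{i_\mu,j_Q}$, $J^{+,\mu}_{i,j-1/2}=J_{i_\mu,j_1}$; $[\![J]\!]=J^+-J^-$ at each interface node. The values $(\widehat{J\frac{\partial\xi_1}{\partial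 t}})^\mu_{i\pm\frac12,j}$ and $(\widehat{J\frac{\partial\xi_2}{\partial t}})^\mu_{i,j\pm\frac12}$ are given real numbers, single-valued at interface nodes (they are $-\sum_k(\partial x_k/\partial t)(J\partial\xi_\ell/\partial x_k)$ with given mesh velocities and discrete metrics), and $$\big(J\tfrac{\partial\xi_1}{\partial t}\big)^\mu_{i\pm\frac12,j}=\big(\widehat{J\tfrac{\partial\xi_1}{\partial t}}\big)^\mu_{i\pm\frac12,j}-\tfrac{(\beta_1)_J}2[\![J]\!]^\mu_{i\pm\frac12,j},\qquad \big(J\tfrac{\partial\xi_2}{\partial t}\big)^\mu_{i,j\pm\frac12}=\big(\widehat{J\tfrac{\partial\xi_2}{\partial t}}\big)^\mu_{i,j\pm\frac12}-\tfrac{(\beta_2)_J}2[\![J]\!]^\mu_{i,j\pm\frac12},$$ $$(\beta_1)_J=\max_{i,j,\mu}\Big|\big(\widehat{J\tfrac{\partial\xi_1}{\partial t}}/J\big)^\mu_{i\pm\frac12,j}\Big|,\qquad (\beta_2)_J=\max_{i,j,\mu}\Big|\big(\widehat{J\tfrac{\partial\xi_2}{\partial t}}/J\big)^\mu_{i,j\pm\frac12}\Big|,$$ where the maxima are over both one-sided traces $J^\pm$ in the denominator (if some $(\beta_\ell)_J=0$, the corresponding term in the time step condition is void). *)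

theory Defs
  imports "HOL-Analysis.Analysis" "HOL-Computational_Algebra.Polynomial"
begin

abbreviation Q :: nat where "Q \<equiv> 4"

text \<open>
  The \<open>n\<close>-point Gauss--Lobatto rule on the reference cell \<open>[-1/2, 1/2]\<close>: both endpoints are
  nodes and the rule is exact up to degree \<open>2 * n - 3\<close>, which determines nodes and weights.
  Positivity, symmetry and normalisation (\<open>p = 1\<close>) of the weights are consequences.
\<close>

definition gauss_lobatto :: "nat \<Rightarrow> (nat \<Rightarrow> real) \<Rightarrow> (nat \<Rightarrow> real) \<Rightarrow> bool" where
  "gauss_lobatto n x \<omega> \<longleftrightarrow>
     strict_mono_on {1..n} x \<and> x 1 = - 1 / 2 \<and> x n = 1 / 2 \<and>
     (\<forall>p :: real poly. degree p \<le> 2 * n - 3 \<longrightarrow>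
        (\<Sum>\<mu> = 1..n. \<omega> \<mu> * poly p (x \<mu>)) = integral {- 1 / 2 .. 1 / 2} (poly p))"

text \<open>
  Cells of an \<open>N1 \<times> N2\<close> grid together with \<open>g\<close> layers of ghost cells on each side.
  The update needs all four neighbours of a cell, so with \<open>g\<close> layers of data it is defined on
  \<open>cells N1 N2 (g - 1)\<close>.
\<close>

definition cells :: "int \<Rightarrow> int \<Rightarrow> int \<Rightarrow> (int \<times> int) set" where
  "cells N1 N2 g = {1 - g .. N1 + g} \<times> {1 - g .. N2 + g}"

text \<open>
  \<open>J i j \<mu> \<nu>\<close> is the reconstructed value of the Jacobian at node \<open>(\<mu>, \<nu>)\<close> of cell \<open>(i, j)\<close>,
  with \<open>\<mu>, \<nu> \<in> {1..Q}\<close>. A half-integer interface index \<open>i + 1/2\<close> is encoded by \<open>i\<close>, so that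
  \<open>i - 1/2\<close> is encoded by \<open>i - 1\<close>; a quantity attached to an interface node is thereby
  single-valued. The suffixes \<open>1\<close> and \<open>2\<close> name the direction normal to the interface.
\<close>

type_synonym nodal = "int \<Rightarrow> int \<Rightarrow> nat \<Rightarrow> nat \<Rightarrow> real"
type_synonym iface = "int \<Rightarrow> int \<Rightarrow> nat \<Rightarrow> real"

definition minus_trace1 :: "nodal \<Rightarrow> iface" where
  "minus_trace1 J i j \<mu> = J i j Q \<mu>"

definition plus_trace1 :: "nodal \<Rightarrow> iface" where
  "plus_trace1 J i j \<mu> = J (i + 1) j 1 \<mu>"

definition minus_trace2 :: "nodal \<Rightarrow> iface" where
  "minus_trace2 J i j \<mu> = J i j \<mu> Q"

definition plus_trace2 :: "nodal \<Rightarrow> iface" where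
  "plus_trace2 J i j \<mu> = J i (j + 1) \<mu> 1"

text \<open>
  Interfaces \<open>(i \<plusminus> 1/2, j)\<close>, respectively \<open>(i, j \<plusminus> 1/2)\<close>, of the cells \<open>(i, j)\<close> in \<open>C\<close>.
\<close>

definition ifaces1 :: "(int \<times> int) set \<Rightarrow> (int \<times> int) set" where
  "ifaces1 C = C \<union> (\<lambda>(i, j). (i - 1, j)) ` C"

definition ifaces2 :: "(int \<times> int) set \<Rightarrow> (int \<times> int) set" where
  "ifaces2 C = C \<union> (\<lambda>(i, j). (i, j - 1)) ` C"

text \<open>
  \<open>H1\<close> and \<open>H2\<close> are the given hatted metric values; both one-sided traces of \<open>J\<close> occur as
  denominators. The sets are finite whenever \<open>C\<close> is.
\<close>

definition beta1 :: "(int \<times> int) set \<Rightarrow> iface \<Rightarrow> nodal \<Rightarrow> real" where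
  "beta1 C H1 J = Max {\<bar>H1 i j \<mu> / T i j \<mu>\<bar> | i j \<mu> T.
     (i, j) \<in> ifaces1 C \<and> \<mu> \<in> {1..Q} \<and> T \<in> {minus_trace1 J, plus_trace1 J}}"

definition beta2 :: "(int \<times> int) set \<Rightarrow> iface \<Rightarrow> nodal \<Rightarrow> real" where
  "beta2 C H2 J = Max {\<bar>H2 i j \<mu> / T i j \<mu>\<bar> | i j \<mu> T.
     (i, j) \<in> ifaces2 C \<and> \<mu> \<in> {1..Q} \<and> T \<in> {minus_trace2 J, plus_trace2 J}}"

definition metric_flux1 :: "real \<Rightarrow> iface \<Rightarrow> nodal \<Rightarrow> iface" where
  "metric_flux1 \<beta> H1 J i j \<mu> =
     H1 i j \<mu> - \<beta> / 2 * (plus_trace1 J i j \<mu> - minus_trace1 J i j \<mu>)"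

definition metric_flux2 :: "real \<Rightarrow> iface \<Rightarrow> nodal \<Rightarrow> iface" where
  "metric_flux2 \<beta> H2 J i j \<mu> =
     H2 i j \<mu> - \<beta> / 2 * (plus_trace2 J i j \<mu> - minus_trace2 J i j \<mu>)"

definition euler_update ::
  "(nat \<Rightarrow> real) \<Rightarrow> real \<Rightarrow> real \<Rightarrow> real \<Rightarrow> iface \<Rightarrow> iface \<Rightarrow> (int \<Rightarrow> int \<Rightarrow> real) \<Rightarrow> int \<Rightarrow> int \<Rightarrow> real" where
  "euler_update \<omega> \<Delta>t \<Delta>\<xi>1 \<Delta>\<xi>2 F1 F2 Jbar i j =
     Jbar i j
     - \<Delta>t / \<Delta>\<xi>1 * (\<Sum>\<mu> = 1..Q. \<omega> \<mu> * (F1 i j \<mu> - F1 (i - 1) j \<mu>))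
     - \<Delta>t / \<Delta>\<xi>2 * (\<Sum>\<mu> = 1..Q. \<omega> \<mu> * (F2 i j \<mu> - F2 i (j - 1) \<mu>))"

text \<open>
  The bound on the time step is taken in the extended reals, where a positive number divided
  by \<open>0\<close> is \<open>\<infinity>\<close>: a term with \<open>\<beta> = 0\<close> imposes no restriction.
\<close>

definition cfl_bound :: "(nat \<Rightarrow> real) \<Rightarrow> real \<Rightarrow> real \<Rightarrow> real \<Rightarrow> real \<Rightarrow> ereal" where
  "cfl_bound \<omega> \<Delta>\<xi>1 \<Delta>\<xi>2 \<beta>1 \<beta>2 =
     1 / 2 * min (ereal (\<omega> 1 * \<Delta>\<xi>1) / ereal \<beta>1) (ereal (\<omega> 1 * \<Delta>\<xi>2) / ereal \<beta>2)"

end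

theory Submission
  imports Defs
begin

text \<open>
  Since \<open>\<beta>\<close> dominates \<open>\<bar>H\<bar> / J\<close> for both traces, \<open>\<bar>H\<bar> \<le> \<beta> * (J\<^sup>+ + J\<^sup>-) / 2\<close>, so the flux through
  each side of a cell is controlled by \<open>\<beta>\<close> times the interior trace alone. Half of the cell average
  is spent on each direction: the time step restriction makes the outflow at most half of the
  boundary layers of the quadrature sum, and the two inner layers leave a strictly positive rest.
  The weights are those of the four-point rule, \<open>1/12, 5/12, 5/12, 1/12\<close>, which the moments of
  degree at most five force.
\<close>

section \<open>Moments of the quadrature rule and the weights they determine\<close>

lemma integral_monom_symmetric:
  "integral {- 1 / 2 .. 1 / 2} (poly (monom (1::real) n)) =
    ((1 / 2) ^ Suc n - (- 1 / 2) ^ Suc n) / Suc n"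
proof -
  have "((\<lambda>t. t ^ n) has_integral
      (1 / 2) ^ Suc n / Suc n - (- 1 / 2) ^ Suc n / Suc n) {- 1 / 2 .. 1 / 2 :: real}"
    by (rule fundamental_theorem_of_calculus)
       (auto intro!: derivative_eq_intros
             simp flip: has_real_derivative_iff_has_vector_derivative simp del: power_Suc)
  moreover have "poly (monom (1::real) n) = (\<lambda>t. t ^ n)"
    by (simp add: poly_monom fun_eq_iff)
  ultimately show ?thesis
    by (simp only: integral_unique diff_divide_distrib)
qed

lemma gauss_lobatto_moment:
  assumes "gauss_lobatto n x \<omega>" and "k \<le> 2 * n - 3"
  shows "(\<Sum>\<mu> = 1..n. \<omega> \<mu> * x \<mu> ^ k) = ((1 / 2) ^ Suc k - (- 1 / 2) ^ Suc k) / Suc k"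
proof -
  have "degree (monom (1::real) k) \<le> 2 * n - 3"
    using assms(2) by (simp add: degree_monom_eq)
  then have "(\<Sum>\<mu> = 1..n. \<omega> \<mu> * poly (monom 1 k) (x \<mu>)) =
      integral {- 1 / 2 .. 1 / 2} (poly (monom 1 k))"
    using assms(1) unfolding gauss_lobatto_def by blast
  then show ?thesis
    by (simp only: integral_monom_symmetric poly_monom mult_1)
qed

lemma sum_one_to_Q: "(\<Sum>\<mu> = 1..Q. f \<mu>) = f 1 + f 2 + f 3 + (f 4 :: real)"
  by (simp add: numeral_eq_Suc)

text \<open>The moment equations are nonlinear only through the unknown inner nodes \<open>a\<close>
  and \<open>b\<close>. Eliminating the weights first yields \<open>a * b\<close> and
  \<open>a + b\<close>; once the nodes are known to be symmetric, the rest is linear in the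
  weights.\<close>

lemma gauss_lobatto_Q_weights:
  assumes "gauss_lobatto Q x \<omega>"
  shows "\<omega> 1 = 1 / 12" "\<omega> 2 = 5 / 12" "\<omega> 3 = 5 / 12" "\<omega> 4 = 1 / 12"
proof -
  define a b where "a = x 2" and "b = x 3"
  have x14: "x 1 = - 1 / 2" "x 4 = 1 / 2"
    using assms by (auto simp: gauss_lobatto_def)
  note moment = gauss_lobatto_moment[OF assms]
  \<comment> \<open>Exactness reaches degree 2 * 4 - 3 = 5. By symmetry of the cell the odd moments
    vanish.\<close>
  have m: "\<omega> 1 + \<omega> 2 + \<omega> 3 + \<omega> 4 = 1"
    "- \<omega> 1 / 2 + \<omega> 2 * a + \<omega> 3 * b + \<omega> 4 / 2 = 0"
    "\<omega> 1 / 4 + \<omega> 2 * a^2 + \<omega> 3 * b^2 + \<omega> 4 / 4 = 1 / 12"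
    "- \<omega> 1 / 8 + \<omega> 2 * a^3 + \<omega> 3 * b^3 + \<omega> 4 / 8 = 0"
    "\<omega> 1 / 16 + \<omega> 2 * a^4 + \<omega> 3 * b^4 + \<omega> 4 / 16 = 1 / 80"
    "- \<omega> 1 / 32 + \<omega> 2 * a^5 + \<omega> 3 * b^5 + \<omega> 4 / 32 = 0"
    using moment[of 0] moment[of 1] moment[of 2] moment[of 3] moment[of 4] moment[of 5]
    unfolding sum_one_to_Q x14 a_def[symmetric] b_def[symmetric]
    by (simp_all add: eval_nat_numeral)
  \<comment> \<open>apply the rule to \<open>(t\<^sup>2 - 1/4) * (t - a) * (t - b)\<close>, which vanishes at all nodes, and to
    \<open>t\<close> times it\<close>
  have "(\<omega> 1 / 16 + \<omega> 2 * a^4 + \<omega> 3 * b^4 + \<omega> 4 / 16)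
      - (a + b) * (- \<omega> 1 / 8 + \<omega> 2 * a^3 + \<omega> 3 * b^3 + \<omega> 4 / 8)
      + (a * b - 1 / 4) * (\<omega> 1 / 4 + \<omega> 2 * a^2 + \<omega> 3 * b^2 + \<omega> 4 / 4)
      + (a + b) / 4 * (- \<omega> 1 / 2 + \<omega> 2 * a + \<omega> 3 * b + \<omega> 4 / 2)
      - a * b / 4 * (\<omega> 1 + \<omega> 2 + \<omega> 3 + \<omega> 4) = 0"
    by (simp add: field_simps eval_nat_numeral)
  then have ab: "a * b = - 1 / 20"
    unfolding m by (simp add: field_simps)
  have "(- \<omega> 1 / 32 + \<omega> 2 * a^5 + \<omega> 3 * b^5 + \<omega> 4 / 32)
      - (a + b) * (\<omega> 1 / 16 + \<omega> 2 * a^4 + \<omega> 3 * b^4 + \<omega> 4 / 16)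
      + (a * b - 1 / 4) * (- \<omega> 1 / 8 + \<omega> 2 * a^3 + \<omega> 3 * b^3 + \<omega> 4 / 8)
      + (a + b) / 4 * (\<omega> 1 / 4 + \<omega> 2 * a^2 + \<omega> 3 * b^2 + \<omega> 4 / 4)
      - a * b / 4 * (- \<omega> 1 / 2 + \<omega> 2 * a + \<omega> 3 * b + \<omega> 4 / 2) = 0"
    by (simp add: field_simps eval_nat_numeral)
  \<comment> \<open>After inserting the moments, what remains is (a + b) * (1/48 - 1/80) =
    0.\<close>
  then have b: "b = - a"
    unfolding m by simp
  have a2: "a^2 = 1 / 20"
    using ab b by (simp add: power2_eq_square)
  have a3: "a^3 = a / 20"
    using a2 by (simp add: eval_nat_numeral)
  have "a \<noteq> 0"
    using a2 by auto
  have even: "\<omega> 1 / 4 + \<omega> 2 / 20 + \<omega> 3 / 20 + \<omega> 4 / 4 = 1 / 12"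
    using m(3) by (simp add: b a2)
  have odd: "(\<omega> 4 - \<omega> 1) / 8 + (\<omega> 2 * a - \<omega> 3 * a) / 20 = 0"
    using m(4) by (simp add: b a3 field_simps)
  \<comment> \<open>The moments of degree 1 and 3 form a homogeneous linear system in
    \<open>\<omega> 4 - \<omega> 1\<close> and \<open>(\<omega> 2 - \<omega> 3) * a\<close> with
    determinant 1/40 - 1/8, which is nonzero, so both unknowns vanish.\<close>
  have eq14: "\<omega> 4 = \<omega> 1"
    using odd m(2) by (simp add: b field_simps)
  then have "\<omega> 2 * a = \<omega> 3 * a"
    using odd by simp
  then have "\<omega> 2 = \<omega> 3"
    using \<open>a \<noteq> 0\<close> by simp
  then show "\<omega> 1 = 1 / 12" "\<omega> 2 = 5 / 12" "\<omega> 3 = 5 / 12" "\<omega> 4 = 1 / 12"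
    using m(1) even eq14 by simp_all
qed

section \<open>Interface flux bounds and the resulting outflow of a cell\<close>

lemma beta1_ge:
  assumes "finite C" "(i, j) \<in> ifaces1 C" "\<mu> \<in> {1..Q}" "T \<in> {minus_trace1 J, plus_trace1 J}"
  shows "\<bar>H i j \<mu> / T i j \<mu>\<bar> \<le> beta1 C H J"
proof -
  let ?S = "{\<bar>H i j \<mu> / T i j \<mu>\<bar> | i j \<mu> T.
     (i, j) \<in> ifaces1 C \<and> \<mu> \<in> {1..Q} \<and> T \<in> {minus_trace1 J, plus_trace1 J}}"
  \<comment> \<open>\<open>Max\<close> is an upper bound only for finite sets; finiteness comes from
    covering the set by the image of a product of finite index sets.\<close>
  have "?S \<subseteq> (\<lambda>((i, j), \<mu>, T). \<bar>H i j \<mu> / T i j \<mu>\<bar>) `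
      (ifaces1 C \<times> {1..Q} \<times> {minus_trace1 J, plus_trace1 J})"
    by force
  then have "finite ?S"
    by (rule finite_subset) (simp add: ifaces1_def assms(1))
  then show ?thesis
    unfolding beta1_def by (rule Max_ge) (use assms in blast)
qed

lemma beta2_ge:
  assumes "finite C" "(i, j) \<in> ifaces2 C" "\<mu> \<in> {1..Q}" "T \<in> {minus_trace2 J, plus_trace2 J}"
  shows "\<bar>H i j \<mu> / T i j \<mu>\<bar> \<le> beta2 C H J"
proof -
  let ?S = "{\<bar>H i j \<mu> / T i j \<mu>\<bar> | i j \<mu> T.
     (i, j) \<in> ifaces2 C \<and> \<mu> \<in> {1..Q} \<and> T \<in> {minus_trace2 J, plus_trace2 J}}"
  have "?S \<subseteq> (\<lambda>((i, j), \<mu>, T). \<bar>H i j \<mu> / T i j \<mu>\<bar>) `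
      (ifaces2 C \<times> {1..Q} \<times> {minus_trace2 J, plus_trace2 J})"
    by force
  then have "finite ?S"
    by (rule finite_subset) (simp add: ifaces2_def assms(1))
  then show ?thesis
    unfolding beta2_def by (rule Max_ge) (use assms in blast)
qed

text \<open>Both bounds rearrange to \<bar>h\<bar> \<le> \<beta> * (p + m) / 2, the mean of the
  dominations by the two traces. The first serves the cell below the interface, whose inner trace is
  \<open>m\<close>; the second serves the cell above it, whose inner trace is
  \<open>p\<close>.\<close>

lemma penalised_flux_bounds:
  fixes h \<beta> p m :: real
  assumes "\<bar>h / p\<bar> \<le> \<beta>" "\<bar>h / m\<bar> \<le> \<beta>" "p > 0" "m > 0"
  shows "h - \<beta> / 2 * (p - m) \<le> \<beta> * m" and "- (\<beta> * p) \<le> h - \<beta> / 2 * (p - m)"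
proof -
  have "\<bar>h\<bar> \<le> \<beta> * p" "\<bar>h\<bar> \<le> \<beta> * m"
    using assms by (simp_all add: abs_divide pos_divide_le_eq)
  then show "h - \<beta> / 2 * (p - m) \<le> \<beta> * m" and "- (\<beta> * p) \<le> h - \<beta> / 2 * (p - m)"
    by (simp_all add: right_diff_distrib abs_le_iff)
qed

lemma metric_flux1_bounds:
  assumes "finite C" "(i, j) \<in> ifaces1 C" "\<mu> \<in> {1..Q}" "J i j Q \<mu> > 0" "J (i + 1) j 1 \<mu> > 0"
  shows "metric_flux1 (beta1 C H J) H J i j \<mu> \<le> beta1 C H J * J i j Q \<mu>"
    and "- (beta1 C H J * J (i + 1) j 1 \<mu>) \<le> metric_flux1 (beta1 C H J) H J i j \<mu>"
  using penalised_flux_bounds[OF beta1_ge[OF assms(1-3), of "plus_trace1 J" J H]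
      beta1_ge[OF assms(1-3), of "minus_trace1 J" J H]] assms(4,5)
  by (simp_all add: metric_flux1_def plus_trace1_def minus_trace1_def)

lemma metric_flux2_bounds:
  assumes "finite C" "(i, j) \<in> ifaces2 C" "\<mu> \<in> {1..Q}" "J i j \<mu> Q > 0" "J i (j + 1) \<mu> 1 > 0"
  shows "metric_flux2 (beta2 C H J) H J i j \<mu> \<le> beta2 C H J * J i j \<mu> Q"
    and "- (beta2 C H J * J i (j + 1) \<mu> 1) \<le> metric_flux2 (beta2 C H J) H J i j \<mu>"
  using penalised_flux_bounds[OF beta2_ge[OF assms(1-3), of "plus_trace2 J" J H]
      beta2_ge[OF assms(1-3), of "minus_trace2 J" J H]] assms(4,5)
  by (simp_all add: metric_flux2_def plus_trace2_def minus_trace2_def)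

text \<open>The comparison is made separately on each line of nodes normal to the face: the outflow
  sees only the two end values, and these enter the quadrature sum with the equal weights
  \<open>\<omega> 1\<close> and \<open>\<omega> Q\<close>. The first index of \<open>a\<close> is
  the normal one, so that one statement covers both directions.\<close>

lemma directional_outflow_less_half_average:
  fixes a :: "nat \<Rightarrow> nat \<Rightarrow> real"
  assumes a: "\<And>\<mu> \<nu>. \<mu> \<in> {1..Q} \<Longrightarrow> \<nu> \<in> {1..Q} \<Longrightarrow> a \<mu> \<nu> > 0"
    and \<omega>: "\<And>\<mu>. \<mu> \<in> {1..Q} \<Longrightarrow> \<omega> \<mu> > 0" "\<omega> Q = \<omega> 1"
    and R: "\<And>\<nu>. \<nu> \<in> {1..Q} \<Longrightarrow> R \<nu> \<le> \<beta> * a Q \<nu>"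
    and L: "\<And>\<nu>. \<nu> \<in> {1..Q} \<Longrightarrow> - (\<beta> * a 1 \<nu>) \<le> L \<nu>"
    and "0 \<le> r" "r * \<beta> \<le> \<omega> 1 / 2"
  shows "r * (\<Sum>\<nu> = 1..Q. \<omega> \<nu> * (R \<nu> - L \<nu>)) <
    (\<Sum>\<mu> = 1..Q. \<Sum>\<nu> = 1..Q. \<omega> \<mu> * \<omega> \<nu> * a \<mu> \<nu>) / 2"
proof -
  have "r * (\<omega> \<nu> * (R \<nu> - L \<nu>)) < (\<Sum>\<mu> = 1..Q. \<omega> \<mu> * \<omega> \<nu> * a \<mu> \<nu>) / 2"
    if \<nu>: "\<nu> \<in> {1..Q}" for \<nu>
  proof -
    have pos: "a 1 \<nu> > 0" "a 4 \<nu> > 0" "\<omega> 2 * a 2 \<nu> > 0" "\<omega> 3 * a 3 \<nu> > 0"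
      using a[OF _ \<nu>] \<omega>(1) by simp_all
    have "r * (R \<nu> - L \<nu>) \<le> r * (\<beta> * (a 4 \<nu> + a 1 \<nu>))"
      using R[OF \<nu>] L[OF \<nu>] \<open>0 \<le> r\<close> by (intro mult_left_mono) (simp_all add: distrib_left)
    also have "\<dots> \<le> \<omega> 1 / 2 * (a 4 \<nu> + a 1 \<nu>)"
      using mult_right_mono[OF \<open>r * \<beta> \<le> \<omega> 1 / 2\<close>, of "a 4 \<nu> + a 1 \<nu>"] pos
      by (simp add: mult.assoc)
    \<comment> \<open>The end nodes match exactly; the positive contributions of nodes 2 and 3 make
      the inequality strict.\<close>
    also have "\<dots> < (\<Sum>\<mu> = 1..Q. \<omega> \<mu> * a \<mu> \<nu>) / 2"
      unfolding sum_one_to_Q using pos \<omega>(2) by (simp add: field_simps)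
    finally have "\<omega> \<nu> * (r * (R \<nu> - L \<nu>)) < \<omega> \<nu> * ((\<Sum>\<mu> = 1..Q. \<omega> \<mu> * a \<mu> \<nu>) / 2)"
      using \<omega>(1)[OF \<nu>] by (rule mult_strict_left_mono)
    then show ?thesis
      by (simp add: sum_distrib_left mult.left_commute mult.commute)
  qed
  then have "(\<Sum>\<nu> = 1..Q. r * (\<omega> \<nu> * (R \<nu> - L \<nu>))) <
      (\<Sum>\<nu> = 1..Q. (\<Sum>\<mu> = 1..Q. \<omega> \<mu> * \<omega> \<nu> * a \<mu> \<nu>) / 2)"
    by (intro sum_strict_mono) auto
  also have "\<dots> = (\<Sum>\<mu> = 1..Q. \<Sum>\<nu> = 1..Q. \<omega> \<mu> * \<omega> \<nu> * a \<mu> \<nu>) / 2"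
    by (subst sum.swap) (simp only: sum_divide_distrib)
  finally show ?thesis
    by (simp only: sum_distrib_left)
qed

section \<open>The time step condition and positivity of the update\<close>

lemma cfl_bound_imp:
  assumes "ereal \<Delta>t \<le> cfl_bound \<omega> \<Delta>\<xi>1 \<Delta>\<xi>2 \<beta>1 \<beta>2"
    and "\<omega> 1 > 0" "\<Delta>\<xi>1 > 0" "\<Delta>\<xi>2 > 0" "\<beta>1 \<ge> 0" "\<beta>2 \<ge> 0"
  shows "\<Delta>t / \<Delta>\<xi>1 * \<beta>1 \<le> \<omega> 1 / 2" "\<Delta>t / \<Delta>\<xi>2 * \<beta>2 \<le> \<omega> 1 / 2"
proof -
  have *: "\<Delta>t / d * \<beta> \<le> \<omega> 1 / 2"
    if "ereal \<Delta>t \<le> 1 / 2 * (ereal (\<omega> 1 * d) / ereal \<beta>)" "d > 0" "\<beta> \<ge> 0" for d \<beta>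
  \<comment> \<open>For \<open>\<beta> = 0\<close> the quotient is infinite and the hypothesis is
    void, but the claim reduces to 0 \<le> \<open>\<omega> 1 / 2\<close>.\<close>
  proof (cases "\<beta> = 0")
    case False
    have "(1 / 2 :: ereal) = ereal (1 / 2)"
      by (simp add: one_ereal_def numeral_eq_ereal)
    then have "\<Delta>t \<le> 1 / 2 * (\<omega> 1 * d / \<beta>)"
      using that(1) False by simp
    then show ?thesis
      using that False by (simp add: field_simps)
  qed (use assms in simp)
  have half: "(0::ereal) \<le> 1 / 2"
    by simp
  have "cfl_bound \<omega> \<Delta>\<xi>1 \<Delta>\<xi>2 \<beta>1 \<beta>2 \<le> 1 / 2 * (ereal (\<omega> 1 * \<Delta>\<xi>1) / ereal \<beta>1)"
    "cfl_bound \<omega> \<Delta>\<xi>1 \<Delta>\<xi>2 \<beta>1 \<beta>2 \<le> 1 / 2 * (ereal (\<omega> 1 * \<Delta>\<xi>2) / ereal \<beta>2)"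
    unfolding cfl_bound_def by (intro ereal_mult_left_mono[OF _ half] min.cobounded1 min.cobounded2)+
  then show "\<Delta>t / \<Delta>\<xi>1 * \<beta>1 \<le> \<omega> 1 / 2" "\<Delta>t / \<Delta>\<xi>2 * \<beta>2 \<le> \<omega> 1 / 2"
    using * assms by (meson order_trans)+
qed

theorem theorem4p2:
  fixes N1 N2 g :: int
    and x \<omega> :: "nat \<Rightarrow> real"
    and \<Delta>t \<Delta>\<xi>1 \<Delta>\<xi>2 :: real
    and Jbar :: "int \<Rightarrow> int \<Rightarrow> real"
    and J :: "int \<Rightarrow> int \<Rightarrow> nat \<Rightarrow> nat \<Rightarrow> real"
    and H1 H2 :: "int \<Rightarrow> int \<Rightarrow> nat \<Rightarrow> real"
  defines "C \<equiv> cells N1 N2 (g - 1)"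
  defines "\<beta>1 \<equiv> beta1 C H1 J" and "\<beta>2 \<equiv> beta2 C H2 J"
  assumes "N1 \<ge> 1" and "N2 \<ge> 1" and "g \<ge> 1"
    and "\<Delta>t > 0" and "\<Delta>\<xi>1 > 0" and "\<Delta>\<xi>2 > 0"
    and "gauss_lobatto Q x \<omega>"
    and "\<forall>(i, j) \<in> cells N1 N2 g.
           (\<Sum>\<mu> = 1..Q. \<Sum>\<nu> = 1..Q. \<omega> \<mu> * \<omega> \<nu> * J i j \<mu> \<nu>) = Jbar i j"
    and "\<forall>(i, j) \<in> cells N1 N2 g. Jbar i j > 0"
    and "\<forall>(i, j) \<in> cells N1 N2 g. \<forall>\<mu> \<in> {1..Q}. \<forall>\<nu> \<in> {1..Q}. J i j \<mu> \<nu> > 0"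
    and "ereal \<Delta>t \<le> cfl_bound \<omega> \<Delta>\<xi>1 \<Delta>\<xi>2 \<beta>1 \<beta>2"
  shows "\<forall>(i, j) \<in> C.
           euler_update \<omega> \<Delta>t \<Delta>\<xi>1 \<Delta>\<xi>2 (metric_flux1 \<beta>1 H1 J) (metric_flux2 \<beta>2 H2 J) Jbar i j > 0"
proof clarify
  fix i j
  assume ij: "(i, j) \<in> C"
  \<comment> \<open>\<open>C\<close> has one ghost layer less than the data, so all four neighbours
    still carry positive nodal values.\<close>
  have fin: "finite C" and "(i + 1, j) \<in> cells N1 N2 g" "(i - 1, j) \<in> cells N1 N2 g"
    "(i, j + 1) \<in> cells N1 N2 g" "(i, j - 1) \<in> cells N1 N2 g" and cell: "(i, j) \<in> cells N1 N2 g"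
    using ij by (auto simp: C_def cells_def)
  then have pos: "J i j \<mu> \<nu> > 0" "J (i + 1) j \<mu> \<nu> > 0" "J (i - 1) j \<mu> \<nu> > 0"
      "J i (j + 1) \<mu> \<nu> > 0" "J i (j - 1) \<mu> \<nu> > 0"
    if "\<mu> \<in> {1..Q}" "\<nu> \<in> {1..Q}" for \<mu> \<nu>
    using assms(13) that by blast+
  have if1: "(i, j) \<in> ifaces1 C" "(i - 1, j) \<in> ifaces1 C"
    and if2: "(i, j) \<in> ifaces2 C" "(i, j - 1) \<in> ifaces2 C"
    using ij by (force simp: ifaces1_def ifaces2_def)+
  have \<omega>: "\<omega> \<mu> > 0" if "\<mu> \<in> {1..Q}" for \<mu>
  proof -
    have "\<mu> = 1 \<or> \<mu> = 2 \<or> \<mu> = 3 \<or> \<mu> = 4"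
      using that by auto
    then show ?thesis
      using gauss_lobatto_Q_weights[OF assms(10)] by auto
  qed
  have \<omega>4: "\<omega> Q = \<omega> 1"
    using gauss_lobatto_Q_weights[OF assms(10)] by simp
  \<comment> \<open>The cell at hand supplies an interface, so each maximum dominates at least one
    absolute value.\<close>
  have "\<beta>1 \<ge> 0" "\<beta>2 \<ge> 0"
    using beta1_ge[OF fin if1(1), of 1 "minus_trace1 J" J H1]
      beta2_ge[OF fin if2(1), of 1 "minus_trace2 J" J H2]
    unfolding \<beta>1_def \<beta>2_def by (simp_all del: abs_divide)
  then have r: "\<Delta>t / \<Delta>\<xi>1 * \<beta>1 \<le> \<omega> 1 / 2" "\<Delta>t / \<Delta>\<xi>2 * \<beta>2 \<le> \<omega> 1 / 2"
    using cfl_bound_imp[OF assms(14)] \<omega>[of 1] assms(8,9) by auto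
  let ?F1 = "metric_flux1 \<beta>1 H1 J" and ?F2 = "metric_flux2 \<beta>2 H2 J"
  have avg: "(\<Sum>\<mu> = 1..Q. \<Sum>\<nu> = 1..Q. \<omega> \<mu> * \<omega> \<nu> * J i j \<mu> \<nu>) = Jbar i j"
    using assms(11) cell by blast
  have "\<Delta>t / \<Delta>\<xi>1 * (\<Sum>\<nu> = 1..Q. \<omega> \<nu> * (?F1 i j \<nu> - ?F1 (i - 1) j \<nu>)) < Jbar i j / 2"
    unfolding avg[symmetric]
  proof (rule directional_outflow_less_half_average)
    show "?F1 i j \<nu> \<le> \<beta>1 * J i j Q \<nu>" if "\<nu> \<in> {1..Q}" for \<nu>
      unfolding \<beta>1_def by (rule metric_flux1_bounds[OF fin if1(1) that]) (use pos that in simp_all)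
    \<comment> \<open>The left interface is encoded by \<open>i - 1\<close>, and its plus trace is
      node 1 of cell \<open>(i - 1) + 1 = i\<close>.\<close>
    show "- (\<beta>1 * J i j 1 \<nu>) \<le> ?F1 (i - 1) j \<nu>" if "\<nu> \<in> {1..Q}" for \<nu>
      using metric_flux1_bounds(2)[OF fin if1(2) that, of J H1] pos that
      by (simp add: \<beta>1_def)
  qed (use pos(1) \<omega> \<omega>4 r assms(7,8) in simp_all)
  \<comment> \<open>Here the normal index of \<open>J\<close> is the second one, so the outflow
    lemma is applied to the transposed nodal array; swapping the sums afterwards recovers the same
    cell average.\<close>
  moreover have "\<Delta>t / \<Delta>\<xi>2 * (\<Sum>\<nu> = 1..Q. \<omega> \<nu> * (?F2 i j \<nu> - ?F2 i (j - 1) \<nu>)) <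
      (\<Sum>\<mu> = 1..Q. \<Sum>\<nu> = 1..Q. \<omega> \<mu> * \<omega> \<nu> * J i j \<nu> \<mu>) / 2"
  proof (rule directional_outflow_less_half_average)
    show "?F2 i j \<nu> \<le> \<beta>2 * J i j \<nu> Q" if "\<nu> \<in> {1..Q}" for \<nu>
      unfolding \<beta>2_def by (rule metric_flux2_bounds[OF fin if2(1) that]) (use pos that in simp_all)
    show "- (\<beta>2 * J i j \<nu> 1) \<le> ?F2 i (j - 1) \<nu>" if "\<nu> \<in> {1..Q}" for \<nu>
      using metric_flux2_bounds(2)[OF fin if2(2) that, of J H2] pos that
      by (simp add: \<beta>2_def)
  qed (use pos(1) \<omega> \<omega>4 r assms(7,9) in simp_all)
  moreover have "(\<Sum>\<mu> = 1..Q. \<Sum>\<nu> = 1..Q. \<omega> \<mu> * \<omega> \<nu> * J i j \<nu> \<mu>) = Jbar i j"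
    unfolding avg[symmetric] by (subst sum.swap) (simp only: mult.commute)
  \<comment> \<open>Each direction removes strictly less than half of
    \<open>Jbar i j\<close>.\<close>
  ultimately show "euler_update \<omega> \<Delta>t \<Delta>\<xi>1 \<Delta>\<xi>2 ?F1 ?F2 Jbar i j > 0"
    unfolding euler_update_def by linarith
qed

end
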